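(* Let $T(n)=n^{-1}\,|\{1\le m\le n: m \text{ has two } m\text{-good pairs}\}|$. For $n\ge1$ write $n=\frac{1}{\sqrt5}c\phi^p$ with $p$ an integer and $\frac1{\sqrt5}\le c<\frac{1}{\sqrt5}\phi$. Then \[ T(n)=\begin{cases} \frac{1}{2\sqrt5\,\phi^4 c}+O(n^{-1/2}) & p \text{ odd},\\ \frac{\sqrt5}{2}c+\frac{1+\phi^{-5}}{2\sqrt5 c}-1+O(n^{-1/2}) & p \text{ even},\ c\le \frac{1+\phi^{-3}}{\sqrt5},\\ 1-\frac{\sqrt5}{2}\phi^{-1}c-\frac{1+\phi^{-2}}{2\sqrt5 c}+O(n^{-1/2}) & p\text{ even},\ c\ge\frac{1+\phi^{-3}}{\sqrt5}. \end{cases} \]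
   Context: $f_k$ denotes the Fibonacci numbers, $f_1=f_2=1$, $f_{k+2}=f_{k+1}+f_k$, and $\phi=(1+\sqrt5)/2$. For positive integers $a_1,a_2$, the $(a_1,a_2)$-Fibonacci walk is $w_k=w_k(a_1,a_2)$ with $w_1=a_1$, $w_2=a_2$, $w_{k+2}=w_{k+1}+w_k$. Let $s(n;a_1,a_2)$ be the integer $s$ with $w_s(a_1,a_2)=n$ ($-\infty$ if none), and $s(n)=\max_{a_1,a_2\ge1}s(n;a_1,a_2)$. A pair $(a_1,a_2)$ is $n$-good if $a_1,a_2\ge1$ and $s(n;a_1,a_2)=s(n)$. The implied constants in $O(\cdot)$ are absolute. *)

theory Defs
  imports Complex_Main "HOL-Library.Extended_Real"
begin

text \<open>Walks are indexed from 1; the value at index 0 is a dummy and every use below requires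
  an index \<open>\<ge> 1\<close>.\<close>

fun fib_walk :: "nat \<Rightarrow> nat \<Rightarrow> nat \<Rightarrow> nat" where
  "fib_walk a b 0 = 0"
| "fib_walk a b (Suc 0) = a"
| "fib_walk a b (Suc (Suc 0)) = b"
| "fib_walk a b (Suc (Suc (Suc k))) = fib_walk a b (Suc (Suc k)) + fib_walk a b (Suc k)"

text \<open>For \<open>a, b \<ge> 1\<close> the index at which the walk takes the value \<open>n\<close> is unique, except that it
  is 1 and 2 when \<open>a = b = n\<close> (see \<open>fib_walk_index_unique\<close>); then the larger one is taken.\<close>

definition walk_steps :: "nat \<Rightarrow> nat \<Rightarrow> nat \<Rightarrow> ereal" where
  "walk_steps n a b =
     (if \<exists>k\<ge>1. fib_walk a b k = n
      then ereal (real (GREATEST k. 1 \<le> k \<and> fib_walk a b k = n))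
      else - \<infinity>)"

text \<open>The set below is finite (see \<open>finite_walk_steps\<close>), so its maximum exists.\<close>

definition max_steps :: "nat \<Rightarrow> ereal" where
  "max_steps n = Max {walk_steps n a b | a b. 1 \<le> a \<and> 1 \<le> b}"

definition good_pairs :: "nat \<Rightarrow> (nat \<times> nat) set" where
  "good_pairs n = {(a, b). 1 \<le> a \<and> 1 \<le> b \<and> walk_steps n a b = max_steps n}"

definition two_good_density :: "nat \<Rightarrow> real" where
  "two_good_density n = real (card {m. 1 \<le> m \<and> m \<le> n \<and> card (good_pairs m) = 2}) / real n"

definition golden :: real where
  "golden = (1 + sqrt 5) / 2"

lemma fib_walk_pos:
  assumes "1 \<le> a" "1 \<le> b"
  shows "1 \<le> k \<Longrightarrow> 1 \<le> fib_walk a b k"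
  using assms by (induction a b k rule: fib_walk.induct) auto

lemma fib_walk_less_Suc:
  assumes "1 \<le> a" "1 \<le> b" "2 \<le> k"
  shows "fib_walk a b k < fib_walk a b (Suc k)"
proof -
  obtain j where k: "k = Suc (Suc j)"
    using assms(3) by (metis add_2_eq_Suc le_Suc_ex)
  show ?thesis
    unfolding k using fib_walk_pos[OF assms(1,2), of "Suc j"] by simp
qed

lemma fib_walk_strict_mono:
  assumes "1 \<le> a" "1 \<le> b" "2 \<le> j" "j < k"
  shows "fib_walk a b j < fib_walk a b k"
  using assms(4)
proof (induction k)
  case (Suc k)
  then show ?case
    using fib_walk_less_Suc[OF assms(1,2), of k] assms(3) by (cases "j = k") auto
qed simp

lemma fib_walk_first_less:
  assumes "1 \<le> a" "1 \<le> b" "3 \<le> k"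
  shows "a < fib_walk a b k"
proof -
  have "a < fib_walk a b 3"
    using assms(2) by (simp add: numeral_3_eq_3)
  also have "\<dots> \<le> fib_walk a b k"
    using fib_walk_strict_mono[OF assms(1,2), of 3 k] assms(3) by (cases "k = 3") auto
  finally show ?thesis .
qed

lemma fib_walk_index_unique:
  assumes "1 \<le> a" "1 \<le> b" "1 \<le> j" "j < k" "fib_walk a b j = fib_walk a b k"
  shows "j = 1 \<and> k = 2 \<and> a = b"
proof -
  have j: "j = 1"
    using fib_walk_strict_mono[OF assms(1,2), of j k] assms(3-5) by fastforce
  moreover have k: "k = 2"
    using fib_walk_first_less[OF assms(1,2), of k] assms(4,5) j by fastforce
  ultimately show ?thesis
    using assms(5) by (simp add: numeral_2_eq_2)
qed

lemma index_le_fib_walk: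
  assumes "1 \<le> a" "1 \<le> b"
  shows "k \<le> fib_walk a b k + 1"
proof (induction k)
  case (Suc k)
  then show ?case
    using fib_walk_less_Suc[OF assms, of k] fib_walk_pos[OF assms, of "Suc k"]
    by (cases "2 \<le> k") auto
qed simp

lemma walk_steps_range:
  assumes "1 \<le> a" "1 \<le> b"
  shows "walk_steps n a b \<in> insert (- \<infinity>) ((\<lambda>k. ereal (real k)) ` {..n + 1})"
proof (cases "\<exists>k\<ge>1. fib_walk a b k = n")
  case True
  define P where "P = (\<lambda>k. 1 \<le> k \<and> fib_walk a b k = n)"
  have bound: "\<And>k. P k \<Longrightarrow> k \<le> n + 1"
    unfolding P_def using index_le_fib_walk[OF assms] by auto
  obtain k where "P k"
    using True by (auto simp: P_def)
  then have "P (Greatest P)"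
    using bound by (rule GreatestI_nat)
  then have "Greatest P \<le> n + 1"
    by (rule bound)
  moreover have "walk_steps n a b = ereal (real (Greatest P))"
    unfolding walk_steps_def P_def using True by (rule if_P)
  ultimately show ?thesis
    by simp
next
  case False
  then have "walk_steps n a b = - \<infinity>"
    unfolding walk_steps_def by (rule if_not_P)
  then show ?thesis
    by simp
qed

lemma finite_walk_steps: "finite {walk_steps n a b | a b. 1 \<le> a \<and> 1 \<le> b}"
  by (rule finite_subset[of _ "insert (- \<infinity>) ((\<lambda>k. ereal (real k)) ` {..n + 1})"])
     (use walk_steps_range in blast, simp)

end

theory Submission
  imports Defs "HOL-Number_Theory.Fib"
begin

text \<open>
  A walk with value \<open>m\<close> at index \<open>j + 2\<close> is a representation \<open>m = fib j * a + fib (j + 1) * b\<close>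
  with \<open>a, b \<ge> 1\<close>, and it extends backwards by one step exactly if \<open>a < b\<close>. Hence \<open>s(m) = j + 2\<close>
  means that \<open>m\<close> is representable at level \<open>j\<close> and every representation has \<open>b \<le> a\<close>. Since
  representations differ by multiples of \<open>(fib (j + 1), - fib j)\<close>, there are two of them exactly if
  one lies in the triangle \<open>fib j < b \<le> a \<le> fib (j + 1)\<close>, and then that one is unique. So the \<open>m \<le> n\<close>
  with two good pairs are counted by the lattice points of these triangles below the line
  \<open>fib j * a + fib (j + 1) * b = n\<close>. All triangles but one are entirely below or above the line; for
  even \<open>p\<close> the line cuts one triangle, and the case distinction on \<open>c\<close> is whether it passes the corner
  \<open>(fib (j + 1), fib j)\<close>. Counting lattice points row by row gives the area up to a multiple of
  \<open>fib (j + 1)\<close>, which is of the order of the square root of \<open>n\<close>.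
\<close>

subsection \<open>Pairs reaching a value at a given level\<close>

lemma fib_walk_eq_fib: "fib_walk a b (Suc (Suc k)) = fib k * a + fib (Suc k) * b"
  by (induction k rule: fib.induct) (auto simp: algebra_simps)

text \<open>Level \<open>j\<close> stands for walk index \<open>j + 2\<close>. At level 0 the
  coefficient \<open>fib 0 = 0\<close> leaves \<open>a\<close> free.\<close>

definition level_pairs :: "nat \<Rightarrow> nat \<Rightarrow> (nat \<times> nat) set" where
  "level_pairs j m = {(a, b). 1 \<le> a \<and> 1 \<le> b \<and> fib j * a + fib (Suc j) * b = m}"

text \<open>Dropping the first term turns the walk from \<open>(a, b)\<close> into the walk from
  \<open>(b, a + b)\<close>, which reaches \<open>m\<close> one index earlier.\<close>

lemma level_pairs_Suc:
  "level_pairs (Suc j) m = {(a, b). (b, a + b) \<in> level_pairs j m \<and> 1 \<le> a}"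
  by (auto simp: level_pairs_def algebra_simps)

lemma level_pairs_empty_mono:
  assumes "level_pairs i m = {}" "i \<le> j"
  shows "level_pairs j m = {}"
  using assms(2,1) by (induction j rule: dec_induct) (auto simp: level_pairs_Suc)

text \<open>Emptiness passes on to all higher levels, so no walk reaches \<open>m\<close> after
  index \<open>j + 2\<close>. Some walk does so at that index, which is therefore the
  maximum.\<close>

lemma good_pairs_eq_level_pairs:
  assumes "level_pairs j m \<noteq> {}" "level_pairs (Suc j) m = {}"
  shows "good_pairs m = level_pairs j m"
proof -
  have level: "i \<le> j" if "1 \<le> a" "1 \<le> b" "fib_walk a b (Suc (Suc i)) = m" for a b i
  proof (rule ccontr)
    assume "\<not> i \<le> j"
    then have "level_pairs i m = {}"
      using level_pairs_empty_mono[OF assms(2), of i] by simp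
    moreover have "(a, b) \<in> level_pairs i m"
      using that by (simp add: level_pairs_def fib_walk_eq_fib)
    ultimately show False by blast
  qed
  \<comment> \<open>Indices 0 and 1 correspond to no level but satisfy the bound trivially.\<close>
  have index: "k \<le> Suc (Suc j)" if "1 \<le> a" "1 \<le> b" "fib_walk a b k = m" for a b k
  proof (cases "k \<le> 1")
    case False
    then obtain i where "k = Suc (Suc i)"
      by (metis One_nat_def not_less_eq_eq le_Suc_ex add_Suc plus_1_eq_Suc)
    then show ?thesis using level that by blast
  qed simp
  have in_level: "(a, b) \<in> level_pairs j m \<longleftrightarrow>
      1 \<le> a \<and> 1 \<le> b \<and> fib_walk a b (Suc (Suc j)) = m" for a b
    by (simp add: level_pairs_def fib_walk_eq_fib)
  have steps_in: "walk_steps m a b = ereal (real (Suc (Suc j)))"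
    if "(a, b) \<in> level_pairs j m" for a b
  proof -
    have "(GREATEST k. 1 \<le> k \<and> fib_walk a b k = m) = Suc (Suc j)"
      using that index by (intro Greatest_equality) (auto simp: in_level)
    then show ?thesis
      using that unfolding walk_steps_def in_level by (metis le_add1 plus_1_eq_Suc)
  qed
  have steps_le: "walk_steps m a b \<le> ereal (real (Suc (Suc j))) \<and>
     (walk_steps m a b = ereal (real (Suc (Suc j))) \<longrightarrow> (a, b) \<in> level_pairs j m)"
    if "1 \<le> a" "1 \<le> b" for a b
  proof (cases "\<exists>k\<ge>1. fib_walk a b k = m")
    case True
    define g where "g = (GREATEST k. 1 \<le> k \<and> fib_walk a b k = m)"
    have "1 \<le> g \<and> fib_walk a b g = m"
      unfolding g_def using True index[OF that]
      by (intro GreatestI_ex_nat[where P = "\<lambda>k. 1 \<le> k \<and> fib_walk a b k = m"]) auto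
    then have g: "fib_walk a b g = m" "g \<le> Suc (Suc j)"
      using index[OF that] by auto
    have "walk_steps m a b = ereal (real g)"
      unfolding walk_steps_def g_def using True by (rule if_P)
    moreover have "(a, b) \<in> level_pairs j m" if "g = Suc (Suc j)"
      using g \<open>1 \<le> a\<close> \<open>1 \<le> b\<close> that by (simp add: in_level)
    ultimately show ?thesis
      using g(2) by (simp del: of_nat_Suc)
  next
    case False
    then have "walk_steps m a b = - \<infinity>"
      unfolding walk_steps_def by (rule if_not_P)
    then show ?thesis by simp
  qed
  have "max_steps m = ereal (real (Suc (Suc j)))"
    unfolding max_steps_def
  proof (rule Max_eqI[OF finite_walk_steps])
    obtain a b where ab: "(a, b) \<in> level_pairs j m"
      using assms(1) by auto
    show "ereal (real (Suc (Suc j))) \<in> {walk_steps m a b |a b. 1 \<le> a \<and> 1 \<le> b}"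
      using steps_in[OF ab] ab in_level by force
  qed (use steps_le in blast)
  then show ?thesis
    using steps_le steps_in in_level unfolding good_pairs_def by auto
qed

text \<open>Level 0 contains \<open>(1, m)\<close>, while level \<open>m\<close> is empty because
  every walk exceeds \<open>m\<close> at index \<open>m + 2\<close>. The level sought precedes the
  first empty one.\<close>

lemma ex_top_level:
  assumes "1 \<le> m"
  obtains j where "level_pairs j m \<noteq> {}" "level_pairs (Suc j) m = {}"
proof -
  have "(1, m) \<in> level_pairs 0 m"
    using assms by (simp add: level_pairs_def)
  moreover have "level_pairs m m = {}"
  proof -
    have False if "(a, b) \<in> level_pairs m m" for a b
      using index_le_fib_walk[of a b "Suc (Suc m)"] that
      by (auto simp: level_pairs_def fib_walk_eq_fib)
    then show ?thesis by auto
  qed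
  ultimately obtain j where "j < m" "level_pairs j m \<noteq> {}" "level_pairs (Suc j) m = {}"
    using ex_least_nat_less[of "\<lambda>i. level_pairs i m = {}" m] by (metis empty_iff order.refl)
  then show ?thesis using that by blast
qed

text \<open>Subtract the two representations and use that consecutive Fibonacci numbers are coprime.
  The shift \<open>t\<close> may be negative, hence the passage to integers.\<close>

lemma level_pairs_param:
  assumes "1 \<le> j" "(a, b) \<in> level_pairs j m" "(u, v) \<in> level_pairs j m"
  obtains t where "int u = int a + t * int (fib (Suc j))" "int v = int b - t * int (fib j)"
proof -
  have pos: "0 < fib j" using assms(1) by (simp add: fib_neq_0_nat)
  have eq: "int (fib j) * (int u - int a) = int (fib (Suc j)) * (int b - int v)"
  proof -
    have "int (fib j * a + fib (Suc j) * b) = int (fib j * u + fib (Suc j) * v)"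
      using assms(2,3) by (simp add: level_pairs_def)
    then show ?thesis by (simp add: algebra_simps)
  qed
  have cop: "coprime (int (fib j)) (int (fib (Suc j)))"
    using coprime_fib_Suc_nat[of j] by (simp only: coprime_int_iff)
  have "int (fib (Suc j)) dvd int (fib j) * (int u - int a)"
    unfolding eq by simp
  then have "int (fib (Suc j)) dvd int u - int a"
    using cop by (simp add: coprime_dvd_mult_right_iff coprime_commute)
  then obtain t where t: "int u - int a = int (fib (Suc j)) * t" by blast
  have "int (fib (Suc j)) * (int b - int v) = int (fib (Suc j)) * (int (fib j) * t)"
    unfolding eq[symmetric] t by simp
  then have "int b - int v = int (fib j) * t"
    using pos assms(1) by (subst (asm) mult_left_cancel) (auto simp: fib_neq_0_nat)
  with t show ?thesis
    by (intro that[of t]) (auto simp: algebra_simps)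
qed

section \<open>Numbers with exactly two representations at their top level\<close>

text \<open>The inequality \<open>fib j < b\<close> keeps the shifted pair
  \<open>(a + fib (Suc j), b - fib j)\<close> positive, \<open>b \<le> a\<close> rules out a
  backward step, and \<open>a \<le> fib (Suc j)\<close> rules out a shift in the other
  direction.\<close>

definition two_good_triangle :: "nat \<Rightarrow> (nat \<times> nat) set" where
  "two_good_triangle j = {(a, b). fib j < b \<and> b \<le> a \<and> a \<le> fib (Suc j)}"

lemma fib_Suc_le_double: "1 \<le> j \<Longrightarrow> fib (Suc j) \<le> 2 * fib j"
  by (cases j) (auto simp: fib_mono)

text \<open>A shift by \<open>t < 0\<close> would make the first entry nonpositive, and
  \<open>t \<ge> 2\<close> the second, since \<open>b \<le> fib (Suc j) \<le> 2 * fib j\<close>.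
  This leaves \<open>t = 0\<close> and \<open>t = 1\<close>.\<close>

lemma triangle_top_level:
  assumes "1 \<le> j" "(a, b) \<in> two_good_triangle j" "fib j * a + fib (Suc j) * b = m"
  shows "level_pairs (Suc j) m = {}"
    and "level_pairs j m = {(a, b), (a + fib (Suc j), b - fib j)}"
proof -
  have ab: "fib j < b" "b \<le> a" "a \<le> fib (Suc j)"
    using assms(2) by (auto simp: two_good_triangle_def)
  have mem: "(a, b) \<in> level_pairs j m"
    using ab assms(3) by (auto simp: level_pairs_def)
  have *: "(u, v) = (a, b) \<or> (u, v) = (a + fib (Suc j), b - fib j)"
    if uv: "(u, v) \<in> level_pairs j m" for u v
  proof -
    obtain t where t: "int u = int a + t * int (fib (Suc j))" "int v = int b - t * int (fib j)"
      using level_pairs_param[OF assms(1) mem uv] .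
    have pos: "1 \<le> u" "1 \<le> v" using uv by (auto simp: level_pairs_def)
    have "0 \<le> t"
    proof (rule ccontr)
      assume "\<not> 0 \<le> t"
      then have "t * int (fib (Suc j)) \<le> - 1 * int (fib (Suc j))"
        by (intro mult_right_mono) auto
      then show False using t(1) ab pos by linarith
    qed
    moreover have "t < 2"
    proof (rule ccontr)
      assume "\<not> t < 2"
      then have "2 * int (fib j) \<le> t * int (fib j)"
        by (intro mult_right_mono) auto
      then show False using t(2) ab pos fib_Suc_le_double[OF assms(1)] by linarith
    qed
    ultimately have "t = 0 \<or> t = 1" by linarith
    then show ?thesis using t ab by auto
  qed
  have "(a + fib (Suc j), b - fib j) \<in> level_pairs j m"
    using mem ab by (auto simp: level_pairs_def algebra_simps diff_mult_distrib2)
  then show "level_pairs j m = {(a, b), (a + fib (Suc j), b - fib j)}"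
    using * mem by auto
  \<comment> \<open>A pair at the next level would give one here whose first entry is below the
    second; neither of the two pairs is of this form.\<close>
  show "level_pairs (Suc j) m = {}"
    using * ab by (fastforce simp: level_pairs_Suc)
qed

lemma card_good_pairs_triangle:
  assumes "1 \<le> j" "(a, b) \<in> two_good_triangle j"
  shows "card (good_pairs (fib j * a + fib (Suc j) * b)) = 2"
proof -
  note t = triangle_top_level[OF assms refl]
  have "fib (Suc j) \<noteq> 0" by (simp add: fib_neq_0_nat)
  then show ?thesis
    using good_pairs_eq_level_pairs[OF _ t(1)] t(2) by (simp add: card_insert_if)
qed

text \<open>Of the two representations, the one with the smaller first entry lies in the triangle:
  the other one forces \<open>fib j < b\<close>, emptiness of the next level forces
  \<open>b \<le> a\<close>, and the absence of a third one forces
  \<open>a \<le> fib (Suc j)\<close>.\<close>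

lemma card_good_pairs_eq_2E:
  assumes "1 \<le> m" "card (good_pairs m) = 2"
  obtains j a b where "1 \<le> j" "(a, b) \<in> two_good_triangle j"
    "m = fib j * a + fib (Suc j) * b"
proof -
  obtain j where j: "level_pairs j m \<noteq> {}" "level_pairs (Suc j) m = {}"
    using ex_top_level[OF assms(1)] .
  have card: "card (level_pairs j m) = 2"
    using assms(2) good_pairs_eq_level_pairs[OF j] by simp
  have fin: "finite (level_pairs j m)"
    using card by (metis card.infinite zero_neq_numeral)
  \<comment> \<open>At level 0 all pairs \<open>(a, m)\<close> occur, so that level is infinite and
    cannot have two elements.\<close>
  have "1 \<le> j"
  proof (rule ccontr)
    assume "\<not> 1 \<le> j"
    then have "j = 0" by simp
    then have "(\<lambda>a. (a, m)) ` {1..} \<subseteq> level_pairs j m"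
      using assms(1) by (simp add: level_pairs_def image_subset_iff)
    then have "finite ((\<lambda>a. (a, m)) ` {1::nat..})"
      using fin by (rule finite_subset)
    then show False
      by (simp add: finite_image_iff inj_on_def infinite_Ici)
  qed
  obtain P Q where PQ: "level_pairs j m = {P, Q}" "P \<noteq> Q"
    using card by (auto simp: card_2_iff)
  obtain a b u v where eq: "level_pairs j m = {(a, b), (u, v)}" "(a, b) \<noteq> (u, v)" "a \<le> u"
  proof (cases "fst P \<le> fst Q")
    case True
    with PQ show ?thesis
      by (intro that[of "fst P" "snd P" "fst Q" "snd Q"]) auto
  next
    case False
    with PQ show ?thesis
      by (intro that[of "fst Q" "snd Q" "fst P" "snd P"]) auto
  qed
  have mem: "(a, b) \<in> level_pairs j m" "(u, v) \<in> level_pairs j m"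
    using eq(1) by auto
  obtain t where t: "int u = int a + t * int (fib (Suc j))" "int v = int b - t * int (fib j)"
    using level_pairs_param[OF \<open>1 \<le> j\<close> mem] .
  have "0 < t"
  proof (rule ccontr)
    assume "\<not> 0 < t"
    moreover have "t \<noteq> 0" using t eq(2) by auto
    ultimately have "t * int (fib (Suc j)) \<le> - 1 * int (fib (Suc j))"
      by (intro mult_right_mono) auto
    moreover have "0 < int (fib (Suc j))" by (simp add: fib_neq_0_nat)
    ultimately show False using t(1) eq(3) by linarith
  qed
  then have "1 * int (fib j) \<le> t * int (fib j)"
    by (intro mult_right_mono) auto
  then have "fib j < b"
    using t(2) mem(2) by (auto simp: level_pairs_def)
  moreover have "b \<le> a"
  proof (rule ccontr)
    assume "\<not> b \<le> a"
    then obtain d where "b = a + Suc d"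
      using less_imp_Suc_add[of a b] by auto
    then have "(Suc d, a) \<in> level_pairs (Suc j) m"
      using mem(1) by (auto simp: level_pairs_def algebra_simps)
    then show False using j(2) by blast
  qed
  \<comment> \<open>Otherwise a backward shift gives a further pair, distinct from both since its
    first entry is below \<open>a \<le> u\<close>.\<close>
  moreover have "a \<le> fib (Suc j)"
  proof (rule ccontr)
    assume "\<not> a \<le> fib (Suc j)"
    then have "(a - fib (Suc j), b + fib j) \<in> level_pairs j m"
      using mem(1) by (auto simp: level_pairs_def algebra_simps diff_mult_distrib2)
    moreover have "fib (Suc j) \<noteq> 0" by (simp add: fib_neq_0_nat)
    ultimately show False
      using eq \<open>\<not> a \<le> fib (Suc j)\<close> by auto
  qed
  ultimately show ?thesis
    using \<open>1 \<le> j\<close> mem(1) that by (auto simp: two_good_triangle_def level_pairs_def)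
qed

section \<open>Counting by disjoint triangles\<close>

definition triangle_upto :: "nat \<Rightarrow> nat \<Rightarrow> (nat \<times> nat) set" where
  "triangle_upto j n = {(a, b) \<in> two_good_triangle j. fib j * a + fib (Suc j) * b \<le> n}"

lemma finite_two_good_triangle: "finite (two_good_triangle j)"
  by (rule finite_subset[of _ "{..fib (Suc j)} \<times> {..fib (Suc j)}"])
     (auto simp: two_good_triangle_def)

text \<open>The value of the linear form determines the triangle, because its top level is unique,
  and then the point, because the second representation has first entry above
  \<open>fib (Suc i)\<close>. The assumption makes the sum finite.\<close>

lemma card_two_good_eq_sum:
  assumes "\<And>i. j < i \<Longrightarrow> triangle_upto i n = {}"
  shows "card {m. 1 \<le> m \<and> m \<le> n \<and> card (good_pairs m) = 2} =
    (\<Sum>i\<in>{1..j}. card (triangle_upto i n))"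
proof -
  define val where "val i = (\<lambda>(a, b). fib i * a + fib (Suc i) * b)" for i
  have set_eq: "{m. 1 \<le> m \<and> m \<le> n \<and> card (good_pairs m) = 2} =
    (\<Union>i\<in>{1..j}. val i ` triangle_upto i n)"
  proof (intro equalityI subsetI)
    fix m assume m: "m \<in> {m. 1 \<le> m \<and> m \<le> n \<and> card (good_pairs m) = 2}"
    then obtain i a b where i: "1 \<le> i" "(a, b) \<in> two_good_triangle i"
      "m = fib i * a + fib (Suc i) * b"
      using card_good_pairs_eq_2E by (metis (lifting) mem_Collect_eq)
    then have "(a, b) \<in> triangle_upto i n"
      using m by (auto simp: triangle_upto_def)
    moreover from this have "i \<le> j"
      using assms[of i] by (metis empty_iff not_less)
    ultimately show "m \<in> (\<Union>i\<in>{1..j}. val i ` triangle_upto i n)"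
      using i by (force simp: val_def)
  next
    fix m assume "m \<in> (\<Union>i\<in>{1..j}. val i ` triangle_upto i n)"
    then obtain i a b where i: "1 \<le> i" "(a, b) \<in> two_good_triangle i" "m \<le> n"
      "m = fib i * a + fib (Suc i) * b"
      by (auto simp: val_def triangle_upto_def)
    moreover from this have "card (good_pairs m) = 2"
      using card_good_pairs_triangle by blast
    moreover have "1 \<le> m"
      using i by (auto simp: two_good_triangle_def fib_neq_0_nat Suc_le_eq)
    ultimately show "m \<in> {m. 1 \<le> m \<and> m \<le> n \<and> card (good_pairs m) = 2}"
      by blast
  qed
  have disj: "val i ` triangle_upto i n \<inter> val k ` triangle_upto k n = {}"
    if "1 \<le> i" "i < k" for i k
  proof (rule ccontr)
    assume "\<not> ?thesis"
    then obtain a b u v where *: "(a, b) \<in> two_good_triangle i" "(u, v) \<in> two_good_triangle k"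
      "fib i * a + fib (Suc i) * b = fib k * u + fib (Suc k) * v"
      by (auto simp: val_def triangle_upto_def)
    then have "level_pairs k (fib k * u + fib (Suc k) * v) = {}"
      using level_pairs_empty_mono[OF triangle_top_level(1)[OF that(1) *(1) *(3)], of k] that
      by auto
    then show False
      using triangle_top_level(2)[OF _ *(2) refl] that by auto
  qed
  have inj: "inj_on (val i) (triangle_upto i n)" if i: "1 \<le> i" for i
  proof (rule inj_onI, clarify)
    fix a b u v
    assume "(a, b) \<in> triangle_upto i n" "(u, v) \<in> triangle_upto i n" "val i (a, b) = val i (u, v)"
    then have *: "(a, b) \<in> two_good_triangle i" "(u, v) \<in> two_good_triangle i"
      "fib i * u + fib (Suc i) * v = fib i * a + fib (Suc i) * b"
      by (auto simp: val_def triangle_upto_def)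
    have "(u, v) \<in> {(a, b), (a + fib (Suc i), b - fib i)}"
      using triangle_top_level(2)[OF i *(1) refl] triangle_top_level(2)[OF i *(2) *(3)] by auto
    then show "a = u \<and> b = v"
      using *(1,2) by (auto simp: two_good_triangle_def)
  qed
  have "card (\<Union>i\<in>{1..j}. val i ` triangle_upto i n) =
      (\<Sum>i\<in>{1..j}. card (val i ` triangle_upto i n))"
  proof (rule card_UN_disjoint)
    show "\<forall>i\<in>{1..j}. finite (val i ` triangle_upto i n)"
      using finite_two_good_triangle by (auto simp: triangle_upto_def intro: finite_subset)
    show "\<forall>i\<in>{1..j}. \<forall>k\<in>{1..j}. i \<noteq> k \<longrightarrow>
        val i ` triangle_upto i n \<inter> val k ` triangle_upto k n = {}"
      using disj by (metis Int_commute atLeastAtMost_iff linorder_neqE_nat)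
  qed simp
  also have "\<dots> = (\<Sum>i\<in>{1..j}. card (triangle_upto i n))"
    by (rule sum.cong[OF refl], rule card_image[OF inj]) simp
  finally show ?thesis unfolding set_eq .
qed

subsection \<open>Lattice points of a triangle below a line\<close>

text \<open>The quotient is the integral of \<open>max 0 (\<alpha> - \<beta> * t)\<close> over
  \<open>t\<close> from \<open>x\<close> to \<open>y\<close>. The integrand is nonincreasing, so the
  integral lies between its right and left Riemann sums, which differ by
  \<open>h x - h y\<close>.\<close>

lemma sum_pos_part_linear:
  fixes \<alpha> \<beta> :: real
  assumes "0 < \<beta>" "x \<le> y"
  defines "h \<equiv> \<lambda>b::nat. max 0 (\<alpha> - \<beta> * real b)"
  shows "(\<Sum>b\<in>{x<..y}. h b) \<le> ((h x)\<^sup>2 - (h y)\<^sup>2) / (2 * \<beta>)"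
    and "((h x)\<^sup>2 - (h y)\<^sup>2) / (2 * \<beta>) \<le> (\<Sum>b\<in>{x<..y}. h b) + (h x - h y)"
proof -
  \<comment> \<open>The comparison on one unit interval; if \<open>h (Suc k) = 0\<close>, the
    integrand may reach zero inside it.\<close>
  have incr: "h (Suc k) \<le> ((h k)\<^sup>2 - (h (Suc k))\<^sup>2) / (2 * \<beta>) \<and>
      ((h k)\<^sup>2 - (h (Suc k))\<^sup>2) / (2 * \<beta>) \<le> h k" for k
  proof (cases "0 < \<alpha> - \<beta> * real (Suc k)")
    case True
    then have "h k = h (Suc k) + \<beta>"
      using assms(1) by (simp add: h_def algebra_simps max_def)
    then have "((h k)\<^sup>2 - (h (Suc k))\<^sup>2) / (2 * \<beta>) = h (Suc k) + \<beta> / 2"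
      using assms(1) by (simp add: field_simps power2_eq_square)
    then show ?thesis
      using assms(1) \<open>h k = h (Suc k) + \<beta>\<close> by simp
  next
    case False
    then have "h (Suc k) = 0" "0 \<le> h k" "h k \<le> \<beta>"
      using assms(1) by (auto simp: h_def algebra_simps max_def)
    moreover from this have "h k * h k \<le> h k * \<beta>" "0 \<le> h k * \<beta>"
      by (auto intro: mult_left_mono)
    then have "h k * h k \<le> 2 * (h k * \<beta>)"
      by linarith
    ultimately show ?thesis
      using assms(1) by (simp add: field_simps power2_eq_square)
  qed
  have "(\<Sum>b\<in>{x<..y}. h b) \<le> ((h x)\<^sup>2 - (h y)\<^sup>2) / (2 * \<beta>) \<and>
     ((h x)\<^sup>2 - (h y)\<^sup>2) / (2 * \<beta>) \<le> (\<Sum>b\<in>{x<..y}. h b) + (h x - h y)"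
    using assms(2)
  proof (induction y rule: dec_induct)
    case (step k)
    have "{x<..Suc k} = insert (Suc k) {x<..k}" using step by auto
    then have "(\<Sum>b\<in>{x<..Suc k}. h b) = h (Suc k) + (\<Sum>b\<in>{x<..k}. h b)" by simp
    then show ?case
      using step.IH incr[of k] by (simp add: diff_divide_distrib)
  qed simp
  then show "(\<Sum>b\<in>{x<..y}. h b) \<le> ((h x)\<^sup>2 - (h y)\<^sup>2) / (2 * \<beta>)"
    and "((h x)\<^sup>2 - (h y)\<^sup>2) / (2 * \<beta>) \<le> (\<Sum>b\<in>{x<..y}. h b) + (h x - h y)"
    by auto
qed

text \<open>The row length \<open>max 0 (min (y - b) (R - b))\<close>, where \<open>R = (n - y b) / x\<close>, is split into positive
  parts of linear functions of \<open>b\<close>; this is valid because \<open>b \<le> y\<close>.\<close>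

lemma card_row:
  fixes x y b n :: nat
  assumes "1 \<le> x" "b \<le> y"
  shows "\<bar>real (card {a \<in> {b..y}. x * a + y * b \<le> n}) -
    (max 0 (real n / x - (real x + y) / x * b) - max 0 ((real n - real x * y) / x - real y / x * b))\<bar> \<le> 1"
proof -
  have x: "0 < real x" using assms(1) by simp
  define R where "R = (real n - real y * b) / x"
  have eqs: "real n / x - (real x + y) / x * b = R - b"
     "(real n - real x * y) / x - real y / x * b = R - y"
    using x by (auto simp: R_def field_simps)
  show ?thesis
  proof (cases "x * b + y * b \<le> n")
    case True
    \<comment> \<open>This is the floor of \<open>R\<close>; the natural subtraction is exact
      because \<open>y * b \<le> n\<close> in this case.\<close>
    define q where "q = (n - y * b) div x"
    have "a \<le> q \<longleftrightarrow> x * a + y * b \<le> n" for a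
    proof -
      have "a \<le> q \<longleftrightarrow> x * a \<le> n - y * b"
        unfolding q_def using assms(1) less_eq_div_iff_mult_less_eq[of x a "n - y * b"]
        by (simp add: mult.commute[of x a])
      moreover have "y * b \<le> n" using True by simp
      ultimately show ?thesis by (simp only: le_diff_conv2)
    qed
    then have set: "{a \<in> {b..y}. x * a + y * b \<le> n} = {b..min y q}" and "b \<le> q"
      using True by (simp_all add: set_eq_iff)
    have "real q \<le> R" "R < real q + 1"
    proof -
      have "x * q \<le> n - y * b" "n - y * b < x * (q + 1)"
        using assms(1) by (auto simp: q_def dividend_less_times_div)
      moreover have "y * b \<le> n" using True by simp
      ultimately have "x * q + y * b \<le> n" "n < x * (q + 1) + y * b"
        by (simp_all only: le_diff_conv2 less_diff_conv2)
      then have "real (x * q + y * b) \<le> real n" "real n < real (x * (q + 1) + y * b)"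
        by (simp_all only: of_nat_le_iff of_nat_less_iff)
      then show "real q \<le> R" "R < real q + 1"
        using x by (auto simp: R_def field_simps)
    qed
    \<comment> \<open>The row has \<open>min y q - b + 1\<close> points, against the length
      \<open>min y R - b\<close>.\<close>
    then show ?thesis
      unfolding set eqs using \<open>b \<le> q\<close> assms(2) by (simp add: max_def min_def of_nat_diff)
  next
    case False
    have "x * b \<le> x * a" if "b \<le> a" for a
      using that by simp
    with False have set: "{a \<in> {b..y}. x * a + y * b \<le> n} = {}"
      by fastforce
    have "real n < real (x * b + y * b)" using False by (simp only: of_nat_less_iff not_le)
    then have "R < b" using x by (simp add: R_def field_simps)
    then show ?thesis
      unfolding set eqs using assms(2) by (simp add: max_def)
  qed
qed

lemma card_triangle_eq_sum:
  "card {(a, b). x < b \<and> b \<le> a \<and> a \<le> y \<and> x * a + y * b \<le> n} =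
    (\<Sum>b\<in>{x<..y}. card {a \<in> {b..y}. x * a + y * b \<le> (n::nat)})"
proof -
  have "{(a, b). x < b \<and> b \<le> a \<and> a \<le> y \<and> x * a + y * b \<le> n} =
    prod.swap ` (SIGMA b:{x<..y}. {a \<in> {b..y}. x * a + y * b \<le> n})"
    by (force simp: image_iff)
  then show ?thesis
    by (simp add: card_image card_SigmaI)
qed

text \<open>The first term is the area of the region \<open>x \<le> b \<le> a\<close> below the
  line, the second that of its part with \<open>a \<ge> y\<close>. Rounding the rows costs at most
  \<open>y\<close>, and replacing the two sums by integrals at most \<open>2 * y\<close> and
  \<open>y\<close>.\<close>

lemma card_triangle_below_line:
  fixes x y n :: nat
  assumes "1 \<le> x" "x \<le> y" "y \<le> 2 * x" "n \<le> y * (x + y)"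
  shows "\<bar>real (card {(a, b). x < b \<and> b \<le> a \<and> a \<le> y \<and> x * a + y * b \<le> n}) -
    ((max 0 (real n - real x * (real x + y)))\<^sup>2 / (real x * (real x + y)) / 2 -
     (max 0 (real n - 2 * (real x * y)))\<^sup>2 / (real x * y) / 2)\<bar> \<le> 4 * real y"
proof -
  have x: "0 < real x" "real x \<le> y" "real y \<le> 2 * x" using assms by auto
  define h1 where "h1 = (\<lambda>b::nat. max 0 (real n / x - (real x + y) / x * b))"
  define h2 where "h2 = (\<lambda>b::nat. max 0 ((real n - real x * y) / x - real y / x * b))"
  have n: "real n \<le> real y * (real x + y)"
    using assms(4) by (metis of_nat_add of_nat_le_iff of_nat_mult)
  have max_div: "max 0 (t / real x) = max 0 t / x" for t
    using x(1) by (simp add: max_def zero_le_divide_iff)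
  have h: "h1 b = max 0 (real n - (real x + y) * b) / x"
    "h2 b = max 0 (real n - real x * y - real y * b) / x" for b
    unfolding h1_def h2_def max_div[symmetric] by (simp_all add: diff_divide_distrib)
  \<comment> \<open>By the bound on \<open>n\<close> the corner \<open>(y, y)\<close> is not
    strictly below the line, so both lengths have run down to zero at \<open>b = y\<close>.\<close>
  have end0: "h1 y = 0" "h2 y = 0"
    using n by (simp_all add: h algebra_simps)
  \<comment> \<open>These products express \<open>x \<le> y \<le> 2 * x\<close> in the quadratic
    form needed to bound the initial lengths linearly.\<close>
  have "real x * (y - x) \<ge> 0" "(y - real x) * (2 * real x - y) \<ge> 0"
    "real x * (2 * real x - y) \<ge> 0"
    using x by auto
  moreover have "0 \<le> real y * x" by simp
  ultimately have "max 0 (real n - (real x + y) * x) \<le> 2 * real y * x"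
    "max 0 (real n - real x * y - real y * x) \<le> real y * x"
    using n by (auto simp: algebra_simps)
  then have start: "h1 x \<le> 2 * real y" "h2 x \<le> real y"
    using x(1) by (simp_all add: h field_simps)
  have sq: "(h1 x)\<^sup>2 / (2 * ((real x + y) / x)) =
       (max 0 (real n - real x * (real x + y)))\<^sup>2 / (real x * (real x + y)) / 2"
    "(h2 x)\<^sup>2 / (2 * (real y / x)) = (max 0 (real n - 2 * (real x * y)))\<^sup>2 / (real x * y) / 2"
    using x by (simp_all add: h power_divide power2_eq_square field_simps)
  have nonneg: "0 \<le> h1 x" "0 \<le> h2 x" by (simp_all add: h1_def h2_def)
  have "(\<Sum>b\<in>{x<..y}. h1 b) \<le> ((h1 x)\<^sup>2 - (h1 y)\<^sup>2) / (2 * ((real x + y) / x))"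
    "((h1 x)\<^sup>2 - (h1 y)\<^sup>2) / (2 * ((real x + y) / x)) \<le> (\<Sum>b\<in>{x<..y}. h1 b) + (h1 x - h1 y)"
    unfolding h1_def by (rule sum_pos_part_linear; use x assms(2) in force)+
  then have s1: "\<bar>(\<Sum>b\<in>{x<..y}. h1 b) - (h1 x)\<^sup>2 / (2 * ((real x + y) / x))\<bar> \<le> h1 x"
    unfolding end0 by simp
  have "(\<Sum>b\<in>{x<..y}. h2 b) \<le> ((h2 x)\<^sup>2 - (h2 y)\<^sup>2) / (2 * (real y / x))"
    "((h2 x)\<^sup>2 - (h2 y)\<^sup>2) / (2 * (real y / x)) \<le> (\<Sum>b\<in>{x<..y}. h2 b) + (h2 x - h2 y)"
    unfolding h2_def by (rule sum_pos_part_linear; use x assms(2) in force)+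
  then have s2: "\<bar>(\<Sum>b\<in>{x<..y}. h2 b) - (h2 x)\<^sup>2 / (2 * (real y / x))\<bar> \<le> h2 x"
    unfolding end0 by simp
  have "\<bar>(\<Sum>b\<in>{x<..y}. real (card {a \<in> {b..y}. x * a + y * b \<le> n}) - (h1 b - h2 b))\<bar>
     \<le> (\<Sum>b\<in>{x<..y}. 1)"
    using card_row[OF assms(1)] unfolding h1_def h2_def
    by (intro order.trans[OF sum_abs] sum_mono) auto
  also have "\<dots> \<le> real y" by simp
  finally have "\<bar>real (card {(a, b). x < b \<and> b \<le> a \<and> a \<le> y \<and> x * a + y * b \<le> n}) -
     ((\<Sum>b\<in>{x<..y}. h1 b) - (\<Sum>b\<in>{x<..y}. h2 b))\<bar> \<le> real y"
    by (simp add: card_triangle_eq_sum sum_subtractf)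
  moreover have "\<bar>((\<Sum>b\<in>{x<..y}. h1 b) - (\<Sum>b\<in>{x<..y}. h2 b)) -
      ((h1 x)\<^sup>2 / (2 * ((real x + y) / x)) - (h2 x)\<^sup>2 / (2 * (real y / x)))\<bar> \<le> 3 * real y"
    using s1 s2 start nonneg by (smt (verit))
  moreover have "\<bar>r - t\<bar> \<le> 4 * real y"
    if "\<bar>r - s\<bar> \<le> real y" "\<bar>s - t\<bar> \<le> 3 * real y" for r s t
    using that by linarith
  ultimately show ?thesis
    unfolding sq by blast
qed

text \<open>The columns have heights 1 to \<open>d\<close>; the factor 2 avoids a division in the
  natural numbers.\<close>

lemma card_triangle: "2 * card {(a, b). x < b \<and> b \<le> a \<and> a \<le> x + d} = d * (d + 1)"
proof -
  have "{(a, b). x < b \<and> b \<le> a \<and> a \<le> x + d} = (SIGMA a:{x<..x + d}. {x<..a})"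
    by auto
  then have "card {(a, b). x < b \<and> b \<le> a \<and> a \<le> x + d} = (\<Sum>a\<in>{x<..x + d}. a - x)"
    by (simp add: card_SigmaI)
  moreover have "2 * (\<Sum>a\<in>{x<..x + d}. a - x) = d * (d + 1)"
  proof (induction d)
    case (Suc d)
    have "{x<..x + Suc d} = insert (x + Suc d) {x<..x + d}" by auto
    then show ?case using Suc by simp
  qed simp
  ultimately show ?thesis by simp
qed

text \<open>Lets Fibonacci products be replaced by powers of \<open>golden\<close> at bounded cost:
  first the numerator is changed, then the denominator.\<close>

lemma square_quotient_close:
  fixes P P' Q Q' :: real
  assumes "1 \<le> Q" "0 < Q'" "0 \<le> P" "0 \<le> P'" "P' \<le> Q'" "\<bar>P - P'\<bar> \<le> 1" "\<bar>Q - Q'\<bar> \<le> 1"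
  shows "\<bar>P\<^sup>2 / Q - P'\<^sup>2 / Q'\<bar> \<le> 7"
proof -
  \<comment> \<open>From \<open>Q' \<le> Q + 1 \<le> 2 * Q\<close> follow
    \<open>P' \<le> 2 * Q\<close> and \<open>P \<le> 3 * Q\<close>, hence the factors 5 and
    2.\<close>
  have "\<bar>(P - P') * ((P + P') / Q)\<bar> \<le> 1 * 5"
    unfolding abs_mult using assms by (intro mult_mono) (auto simp: divide_simps)
  moreover have "\<bar>(P' / Q') * (P' / Q) * (Q' - Q)\<bar> \<le> 1 * 2 * 1"
    unfolding abs_mult using assms by (intro mult_mono) (auto simp: divide_simps)
  moreover have "P\<^sup>2 / Q - P'\<^sup>2 / Q' = (P - P') * ((P + P') / Q) + (P' / Q') * (P' / Q) * (Q' - Q)"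
    using assms(1,2) by (simp add: field_simps power2_eq_square)
  ultimately show ?thesis by linarith
qed

subsection \<open>Asymptotics of Fibonacci products\<close>

lemma golden_sq: "golden ^ 2 = golden + 1"
  by (simp add: golden_def power2_eq_square field_simps)

lemma golden_bounds: "1.6 < golden" "golden < 1.62"
proof -
  have "2.2 < sqrt 5" "sqrt 5 < 2.24"
    by (rule real_less_rsqrt real_less_lsqrt; simp add: power2_eq_square)+
  then show "1.6 < golden" "golden < 1.62" by (simp_all add: golden_def)
qed

text \<open>The base \<open>1 - golden\<close> is the conjugate root \<open>(1 - sqrt 5) / 2\<close>
  of the golden ratio.\<close>

definition conj_power :: "nat \<Rightarrow> real" where
  "conj_power j = (1 - golden) ^ j"

lemma Binet: "sqrt 5 * real (fib j) = golden ^ j - conj_power j"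
proof -
  have "1 - golden = (1 - sqrt 5) / 2" by (simp add: golden_def field_simps)
  then show ?thesis
    using fib_closed_form[of j] by (simp add: golden_def conj_power_def field_simps)
qed

text \<open>The two roots have product -1. Mixed terms in a product of two Binet formulas are
  therefore bounded.\<close>

lemma golden_power_conj_power: "\<bar>golden ^ j * conj_power j\<bar> = 1"
proof -
  have "golden * (1 - golden) = - 1"
    using golden_sq by (simp add: power2_eq_square algebra_simps)
  then show ?thesis
    by (simp add: conj_power_def power_mult_distrib[symmetric] power_abs[symmetric])
qed

lemma conj_power_bound: "\<bar>conj_power j\<bar> \<le> 1"
  unfolding conj_power_def using golden_bounds by (simp add: power_abs power_le_one)

lemma conj_power_sq_bound: "0 \<le> (conj_power j)\<^sup>2" "(conj_power j)\<^sup>2 \<le> 1"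
  using conj_power_bound[of j] by (auto simp: abs_square_le_1)

lemma golden_power_ge_1: "1 \<le> golden ^ j"
  using golden_bounds by (simp add: one_le_power)

lemma five_fib_mult:
  "5 * (real (fib i) * real (fib j)) = (golden ^ i - conj_power i) * (golden ^ j - conj_power j)"
proof -
  have "5 * (real (fib i) * real (fib j)) = (sqrt 5 * real (fib i)) * (sqrt 5 * real (fib j))"
    by simp
  then show ?thesis unfolding Binet .
qed

text \<open>Explicit errors below 5 matter: after division by 5, integrality later removes them from
  inequalities between natural numbers.\<close>

lemma fib_mult_fib_Suc_bounds:
  "golden * (golden ^ j)\<^sup>2 - 2 \<le> 5 * (real (fib j) * real (fib (Suc j)))"
  "5 * (real (fib j) * real (fib (Suc j))) \<le> golden * (golden ^ j)\<^sup>2 + 1"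
proof -
  define e s where "e = golden ^ j" and "s = conj_power j"
  have "5 * (real (fib j) * real (fib (Suc j))) = golden * e\<^sup>2 - e * s - (golden - 1) * s\<^sup>2"
    unfolding five_fib_mult e_def s_def conj_power_def by (simp add: power2_eq_square algebra_simps)
  moreover have "\<bar>e * s\<bar> = 1"
    unfolding e_def s_def by (rule golden_power_conj_power)
  moreover have "0 \<le> (golden - 1) * s\<^sup>2" "(golden - 1) * s\<^sup>2 \<le> 1 * 1"
    unfolding s_def using golden_bounds conj_power_sq_bound[of j]
    by (simp, intro mult_mono) auto
  ultimately show "golden * (golden ^ j)\<^sup>2 - 2 \<le> 5 * (real (fib j) * real (fib (Suc j)))"
    "5 * (real (fib j) * real (fib (Suc j))) \<le> golden * (golden ^ j)\<^sup>2 + 1"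
    unfolding e_def by linarith+
qed

lemma fib_mult_fib_Suc_Suc_bounds:
  "golden\<^sup>2 * (golden ^ j)\<^sup>2 - 3 \<le> 5 * (real (fib j) * real (fib (Suc (Suc j))))"
  "5 * (real (fib j) * real (fib (Suc (Suc j)))) \<le> golden\<^sup>2 * (golden ^ j)\<^sup>2 + 4"
proof -
  define e s where "e = golden ^ j" and "s = conj_power j"
  have "5 * (real (fib j) * real (fib (Suc (Suc j)))) =
    golden\<^sup>2 * e\<^sup>2 - (golden\<^sup>2 + (1 - golden)\<^sup>2) * (e * s) + (1 - golden)\<^sup>2 * s\<^sup>2"
    unfolding five_fib_mult e_def s_def conj_power_def by (simp add: power2_eq_square algebra_simps)
  moreover have "golden\<^sup>2 + (1 - golden)\<^sup>2 = 3"
    using golden_sq by (simp add: power2_eq_square algebra_simps)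
  moreover have "\<bar>e * s\<bar> = 1"
    unfolding e_def s_def by (rule golden_power_conj_power)
  moreover have "0 \<le> (1 - golden)\<^sup>2 * s\<^sup>2" "(1 - golden)\<^sup>2 * s\<^sup>2 \<le> 1 * 1"
    unfolding s_def using golden_bounds conj_power_sq_bound[of j]
    by (simp, intro mult_mono) (auto simp: abs_square_le_1)
  ultimately show "golden\<^sup>2 * (golden ^ j)\<^sup>2 - 3 \<le> 5 * (real (fib j) * real (fib (Suc (Suc j))))"
    "5 * (real (fib j) * real (fib (Suc (Suc j)))) \<le> golden\<^sup>2 * (golden ^ j)\<^sup>2 + 4"
    unfolding e_def by (auto simp: abs_if split: if_splits)
qed

lemma fib_Suc_le_golden_power: "real (fib (Suc j)) \<le> 2 * golden ^ j"
proof -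
  have "2 * real (fib (Suc j)) \<le> sqrt 5 * real (fib (Suc j))"
    by (intro mult_right_mono real_le_rsqrt) auto
  also have "\<dots> \<le> (81 / 50) * golden ^ j + 1"
  proof -
    have "golden * golden ^ j \<le> (81 / 50) * golden ^ j"
      using golden_bounds golden_power_ge_1[of j] by (intro mult_right_mono) auto
    then show ?thesis
      unfolding Binet power_Suc using conj_power_bound[of "Suc j"] by linarith
  qed
  finally show ?thesis
    using golden_power_ge_1[of j] by linarith
qed

text \<open>Adds the sum of squares \<open>fib (m - 1) * fib m\<close> and the plain sum
  \<open>fib (m + 1) - 1\<close>; writing \<open>fib (m - 1)\<close> as a difference covers
  \<open>m = 0\<close>. The summands are twice the sizes of the full triangles.\<close>

lemma sum_fib_mult_Suc:
  "(\<Sum>k<m. real (fib k) * (real (fib k) + 1)) =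
    real (fib m) * (real (fib (Suc m)) - real (fib m)) + real (fib (Suc m)) - 1"
  by (induction m) (auto simp: algebra_simps)

lemma sum_fib_mult_Suc_asymp:
  "\<bar>(\<Sum>k<m. real (fib k) * (real (fib k) + 1)) - (golden ^ m)\<^sup>2 / (5 * golden)\<bar> \<le> 3 * golden ^ m"
proof -
  define e s where "e = golden ^ m" and "s = conj_power m"
  have inv: "1 / golden = golden - 1"
    using golden_sq golden_bounds by (simp add: power2_eq_square field_simps)
  have "5 * (real (fib m) * (real (fib (Suc m)) - real (fib m))) =
      (golden - 1) * e\<^sup>2 + e * s - golden * s\<^sup>2"
    unfolding right_diff_distrib five_fib_mult e_def s_def conj_power_def
    by (simp add: power2_eq_square algebra_simps)
  moreover have "(golden - 1) * e\<^sup>2 = 5 * (e\<^sup>2 / (5 * golden))"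
    unfolding inv[symmetric] by simp
  moreover have "\<bar>e * s\<bar> = 1"
    unfolding e_def s_def by (rule golden_power_conj_power)
  moreover have "0 \<le> golden * s\<^sup>2" "golden * s\<^sup>2 \<le> 2 * 1"
    unfolding s_def using golden_bounds conj_power_sq_bound[of m]
    by (simp, intro mult_mono) auto
  moreover have "1 \<le> e" "real (fib (Suc m)) \<le> 2 * e"
    unfolding e_def by (rule golden_power_ge_1 fib_Suc_le_golden_power)+
  moreover have "0 < real (fib (Suc m))"
    by (simp add: fib_neq_0_nat)
  ultimately show ?thesis
    unfolding sum_fib_mult_Suc e_def[symmetric] by linarith
qed

section \<open>Full and empty triangles\<close>

lemma triangle_upto_eq:
  "triangle_upto j n = {(a, b). fib j < b \<and> b \<le> a \<and> a \<le> fib (Suc j) \<and>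
     fib j * a + fib (Suc j) * b \<le> n}"
  by (auto simp: triangle_upto_def two_good_triangle_def)

text \<open>The linear form is largest at the corner \<open>a = b = fib (Suc (Suc k))\<close>, where
  it equals the product in the assumption. The side length of the triangle is
  \<open>fib k\<close>.\<close>

lemma card_triangle_upto_full:
  assumes "fib (Suc (Suc k)) * fib (Suc (Suc (Suc k))) \<le> n"
  shows "real (card (triangle_upto (Suc k) n)) = real (fib k) * (real (fib k) + 1) / 2"
proof -
  have "fib (Suc k) * a + fib (Suc (Suc k)) * b \<le> n"
    if "b \<le> a" "a \<le> fib (Suc (Suc k))" for a b
  proof -
    have "fib (Suc k) * a + fib (Suc (Suc k)) * b
        \<le> fib (Suc k) * fib (Suc (Suc k)) + fib (Suc (Suc k)) * fib (Suc (Suc k))"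
      using that by (intro add_mono mult_le_mono2) auto
    also have "\<dots> = fib (Suc (Suc k)) * fib (Suc (Suc (Suc k)))"
      by (simp add: algebra_simps)
    finally show ?thesis using assms by simp
  qed
  then have "triangle_upto (Suc k) n =
      {(a, b). fib (Suc k) < b \<and> b \<le> a \<and> a \<le> fib (Suc k) + fib k}"
    by (auto simp: triangle_upto_eq)
  then have "2 * card (triangle_upto (Suc k) n) = fib k * (fib k + 1)"
    using card_triangle[of "fib (Suc k)" "fib k"] by simp
  then have "real (2 * card (triangle_upto (Suc k) n)) = real (fib k * (fib k + 1))"
    by (simp only:)
  then have "2 * real (card (triangle_upto (Suc k) n)) = real (fib k) * (real (fib k) + 1)"
    by (simp only: of_nat_mult of_nat_add of_nat_1 of_nat_numeral)
  then show ?thesis by linarith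
qed

text \<open>The linear form is smallest at \<open>a = b = fib i + 1\<close>, and this value is
  smallest for \<open>i = Suc j\<close>.\<close>

lemma triangle_upto_empty:
  assumes "j < i" "5 * real n < golden ^ 4 * (golden ^ j)\<^sup>2"
  shows "triangle_upto i n = {}"
proof (rule ccontr)
  assume "triangle_upto i n \<noteq> {}"
  then obtain a b where ab: "fib i < b" "b \<le> a" "fib i * a + fib (Suc i) * b \<le> n"
    by (auto simp: triangle_upto_eq)
  let ?x = "fib (Suc j)" and ?z = "fib (Suc (Suc (Suc j)))"
  have "?x * ?z + ?z \<le> (fib i + 1) * fib (Suc (Suc i))"
    using assms(1) fib_mono[of "Suc j" i] fib_mono[of "Suc (Suc (Suc j))" "Suc (Suc i)"]
      mult_le_mono[of "Suc ?x" "fib i + 1" ?z "fib (Suc (Suc i))"] by simp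
  also have "\<dots> = fib i * (fib i + 1) + fib (Suc i) * (fib i + 1)"
    by (simp add: algebra_simps)
  also have "\<dots> \<le> fib i * a + fib (Suc i) * b"
    using ab by (intro add_mono mult_le_mono2) auto
  finally have "?x * ?z + ?z \<le> n" using ab by simp
  then have "real (?x * ?z + ?z) \<le> real n" by (simp only: of_nat_le_iff)
  \<comment> \<open>The summand \<open>?z\<close>, which comes from the strict inequality
    \<open>fib i < b\<close>, outweighs the error 3/5 of the product estimate.\<close>
  moreover have "1 \<le> real ?z"
    using fib_neq_0_nat[of "Suc (Suc (Suc j))"] by linarith
  moreover have "golden\<^sup>2 * (golden ^ Suc j)\<^sup>2 = golden ^ 4 * (golden ^ j)\<^sup>2"
    by (simp add: power2_eq_square eval_nat_numeral mult_ac)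
  ultimately show False
    using fib_mult_fib_Suc_Suc_bounds(1)[of "Suc j"] assms(2) by (simp del: fib.simps)
qed

subsection \<open>The density\<close>

text \<open>Here \<open>n\<close> lies between the largest value on triangle \<open>j\<close> and
  the smallest on triangle \<open>j + 1\<close>, so triangles 1 to \<open>j\<close> are full and the
  later ones empty.\<close>

lemma card_two_good_odd:
  assumes "golden ^ 3 * (golden ^ j)\<^sup>2 \<le> 5 * real n"
    and "5 * real n < golden ^ 4 * (golden ^ j)\<^sup>2"
  shows "\<bar>real (card {m. 1 \<le> m \<and> m \<le> n \<and> card (good_pairs m) = 2})
    - (golden ^ j)\<^sup>2 / (10 * golden)\<bar> \<le> 2 * golden ^ j"
proof -
  have "golden * (golden ^ Suc j)\<^sup>2 = golden ^ 3 * (golden ^ j)\<^sup>2"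
    by (simp add: power2_eq_square eval_nat_numeral mult_ac)
  then have "5 * real (fib (Suc j) * fib (Suc (Suc j))) \<le> 5 * real n + 1"
    using fib_mult_fib_Suc_bounds(2)[of "Suc j"] assms(1) by (simp del: fib.simps)
  \<comment> \<open>The error 1 is less than 5, so integrality removes it.\<close>
  then have top: "fib (Suc j) * fib (Suc (Suc j)) \<le> n"
    by linarith
  have full: "real (card (triangle_upto (Suc k) n)) = real (fib k) * (real (fib k) + 1) / 2"
    if "k < j" for k
  proof (rule card_triangle_upto_full)
    have "fib (Suc (Suc k)) * fib (Suc (Suc (Suc k))) \<le> fib (Suc j) * fib (Suc (Suc j))"
      using that by (intro mult_le_mono fib_mono) auto
    then show "fib (Suc (Suc k)) * fib (Suc (Suc (Suc k))) \<le> n"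
      using top by linarith
  qed
  have "real (card {m. 1 \<le> m \<and> m \<le> n \<and> card (good_pairs m) = 2}) =
      (\<Sum>i\<in>{1..j}. real (card (triangle_upto i n)))"
    by (subst card_two_good_eq_sum[of j]) (use triangle_upto_empty assms(2) in auto)
  also have "\<dots> = (\<Sum>k<j. real (card (triangle_upto (Suc k) n)))"
    by (simp add: sum.atLeast1_atMost_eq)
  also have "\<dots> = (\<Sum>k<j. real (fib k) * (real (fib k) + 1)) / 2"
    unfolding sum_divide_distrib by (intro sum.cong refl full) simp
  finally show ?thesis
    using sum_fib_mult_Suc_asymp[of j] golden_power_ge_1[of j] by (simp add: abs_if split: if_splits)
qed

text \<open>Now the line cuts triangle \<open>j\<close>. With \<open>x = fib j\<close> and
  \<open>y = fib (Suc j)\<close>, \<open>E\<close> approximates the value \<open>x * (x + y)\<close>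
  at the lowest corner \<open>(x, x)\<close> and \<open>E / golden\<close> approximates
  \<open>x * y\<close>. The three terms come from the full triangles, the region below the line, and
  its excess beyond the corner \<open>(y, x)\<close>.\<close>

lemma card_two_good_even:
  assumes "1 \<le> j" and lower: "golden\<^sup>2 * (golden ^ j)\<^sup>2 \<le> 5 * real n"
    and upper: "5 * real n < golden ^ 3 * (golden ^ j)\<^sup>2"
  defines "E \<equiv> golden\<^sup>2 * (golden ^ j)\<^sup>2 / 5"
  shows "\<bar>real (card {m. 1 \<le> m \<and> m \<le> n \<and> card (good_pairs m) = 2})
    - (E / (2 * golden ^ 5) + (real n - E)\<^sup>2 / E / 2
        - (max 0 (real n - 2 * (E / golden)))\<^sup>2 / (E / golden) / 2)\<bar> \<le> 17 * golden ^ j"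
proof -
  obtain i where i: "j = Suc i" using assms(1) by (cases j) auto
  define e where "e = golden ^ j"
  define x y where "x = fib j" and "y = fib (Suc j)"
  have e: "1 \<le> e" unfolding e_def by (rule golden_power_ge_1)
  have g: "1.6 < golden" "golden < 1.62" by (rule golden_bounds)+
  have E: "5 * E = golden\<^sup>2 * e\<^sup>2" "5 * (E / golden) = golden * e\<^sup>2" "0 < E"
    using g e by (simp_all add: E_def e_def power2_eq_square)
  have upper': "real n < golden * E"
    using upper by (simp add: E_def power2_eq_square power3_eq_cube mult_ac)
  have z: "fib (Suc (Suc j)) = x + y" by (simp add: x_def y_def)
  have xy: "1 \<le> x" "x \<le> y" "y \<le> 2 * x"
    using fib_neq_0_nat[of j] assms(1) fib_Suc_mono fib_Suc_le_double
    by (auto simp: x_def y_def simp del: fib.simps)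
  have xy_bounds: "5 * (E / golden) - 2 \<le> 5 * (real x * real y)" "5 * (real x * real y) \<le> 5 * (E / golden) + 1"
    unfolding E(2) e_def x_def y_def by (rule fib_mult_fib_Suc_bounds)+
  have xz_bounds: "5 * E - 3 \<le> 5 * (real x * (real x + real y))" "5 * (real x * (real x + real y)) \<le> 5 * E + 4"
    using fib_mult_fib_Suc_Suc_bounds[of j] unfolding E(1) e_def z by (simp_all add: x_def)
  have "golden * (golden ^ Suc j)\<^sup>2 = golden ^ 3 * (golden ^ j)\<^sup>2"
    by (simp add: power2_eq_square eval_nat_numeral mult_ac)
  then have "5 * real n < 5 * real (y * (x + y)) + 2"
    using fib_mult_fib_Suc_bounds(1)[of "Suc j"] upper unfolding z by (simp add: y_def)
  then have n_le: "n \<le> y * (x + y)" by linarith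
  have full: "real (card (triangle_upto (Suc k) n)) = real (fib k) * (real (fib k) + 1) / 2"
    if "k < i" for k
  proof (rule card_triangle_upto_full)
    have "fib (Suc (Suc k)) * fib (Suc (Suc (Suc k))) \<le> x * y"
      using that unfolding x_def y_def i by (intro mult_le_mono fib_mono) auto
    moreover have "5 * real (x * y) \<le> 5 * real n"
    proof -
      \<comment> \<open>The gap \<open>e\<^sup>2 \<ge> 1\<close> absorbs the error 1 in the estimate
        of \<open>x * y\<close>.\<close>
      have "golden * e\<^sup>2 + e\<^sup>2 = golden\<^sup>2 * e\<^sup>2"
        using golden_sq by (simp add: algebra_simps)
      moreover have "1 \<le> e\<^sup>2" using e by (simp add: one_le_power)
      ultimately show ?thesis
        using xy_bounds(2) E(2) lower by (simp add: e_def)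
    qed
    then have "x * y \<le> n" by linarith
    ultimately show "fib (Suc (Suc k)) * fib (Suc (Suc (Suc k))) \<le> n" by linarith
  qed
  have "5 * real n < golden ^ 4 * (golden ^ j)\<^sup>2"
  proof -
    have "1 * (golden ^ 3 * (golden ^ j)\<^sup>2) \<le> golden * (golden ^ 3 * (golden ^ j)\<^sup>2)"
      using g by (intro mult_right_mono) auto
    then show ?thesis using upper by (simp add: eval_nat_numeral mult_ac)
  qed
  then have "real (card {m. 1 \<le> m \<and> m \<le> n \<and> card (good_pairs m) = 2}) =
      (\<Sum>i\<in>{1..j}. real (card (triangle_upto i n)))"
    by (subst card_two_good_eq_sum[of j]) (use triangle_upto_empty in auto)
  also have "\<dots> = (\<Sum>k<i. real (card (triangle_upto (Suc k) n))) + real (card (triangle_upto j n))"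
    unfolding i by (simp add: sum.atLeast1_atMost_eq)
  also have "(\<Sum>k<i. real (card (triangle_upto (Suc k) n))) =
      (\<Sum>k<i. real (fib k) * (real (fib k) + 1)) / 2"
    unfolding sum_divide_distrib by (intro sum.cong refl full) simp
  finally have N: "real (card {m. 1 \<le> m \<and> m \<le> n \<and> card (good_pairs m) = 2}) =
      (\<Sum>k<i. real (fib k) * (real (fib k) + 1)) / 2 + real (card (triangle_upto j n))" .
  have "golden ^ i \<le> e"
    unfolding e_def i using g by (intro power_increasing) auto
  moreover have "(golden ^ i)\<^sup>2 / (5 * golden) = 2 * (E / (2 * golden ^ 5))"
    using g by (simp add: E_def i field_simps power2_eq_square eval_nat_numeral)
  ultimately have part1: "\<bar>(\<Sum>k<i. real (fib k) * (real (fib k) + 1)) / 2 - E / (2 * golden ^ 5)\<bar> \<le> 2 * e"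
    using sum_fib_mult_Suc_asymp[of i] e by linarith
  have part2: "\<bar>real (card (triangle_upto j n)) -
    ((max 0 (real n - real x * (real x + real y)))\<^sup>2 / (real x * (real x + real y)) / 2 -
     (max 0 (real n - 2 * (real x * real y)))\<^sup>2 / (real x * real y) / 2)\<bar> \<le> 8 * e"
    using card_triangle_below_line[OF xy n_le] fib_Suc_le_golden_power[of j]
    unfolding triangle_upto_eq x_def y_def e_def by linarith
  have ge1: "1 \<le> real x * real y" "1 \<le> real x * (real x + real y)"
    using mult_mono[of 1 "real x" 1 "real y"] mult_mono[of 1 "real x" 1 "real x + real y"] xy by auto
  \<comment> \<open>Gives \<open>n - E \<le> E\<close>, the condition \<open>P' \<le> Q'\<close> for
    comparing the quotients.\<close>
  have "golden * E \<le> 2 * E" using g E(3) by (intro mult_right_mono) auto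
  moreover have "E \<le> real n" using lower E(1) by (simp add: e_def)
  ultimately have part3: "\<bar>(max 0 (real n - real x * (real x + real y)))\<^sup>2 / (real x * (real x + real y)) -
      (real n - E)\<^sup>2 / E\<bar> \<le> 7"
    using ge1 E(3) upper' xz_bounds by (intro square_quotient_close) linarith+
  \<comment> \<open>The same condition for the other quotient,
    \<open>n - 2 * (E / golden) \<le> E / golden\<close>, rests on
    \<open>golden\<^sup>2 \<le> 3\<close>.\<close>
  have "E * (golden * golden) \<le> E * 3"
    using golden_sq g E(3) by (intro mult_left_mono) (auto simp: power2_eq_square)
  then have "golden * E \<le> 3 * (E / golden)"
    using g by (simp add: field_simps)
  moreover have "0 < E / golden" using E(3) g by simp
  ultimately have part4: "\<bar>(max 0 (real n - 2 * (real x * real y)))\<^sup>2 / (real x * real y) -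
      (max 0 (real n - 2 * (E / golden)))\<^sup>2 / (E / golden)\<bar> \<le> 7"
    using ge1 upper' xy_bounds by (intro square_quotient_close) linarith+
  \<comment> \<open>The constant is 2 + 8 + 7/2 + 7/2 = 17, using \<open>1 \<le> e\<close>.\<close>
  have combine: "\<bar>(S + T) - (S' + A' / 2 - B' / 2)\<bar> \<le> 17 * e"
    if "\<bar>S - S'\<bar> \<le> 2 * e" "\<bar>T - (A / 2 - B / 2)\<bar> \<le> 8 * e" "\<bar>A - A'\<bar> \<le> 7" "\<bar>B - B'\<bar> \<le> 7"
    for S S' T A A' B B'
    using that e by linarith
  show ?thesis
    unfolding N e_def[symmetric] by (rule combine[OF part1 part2 part3 part4])
qed

section \<open>Passage from counts to the density\<close>

lemma divide_error_le:
  assumes "\<bar>N - M\<bar> \<le> K * e" "e\<^sup>2 \<le> 4 * real n" "0 \<le> e" "0 \<le> K" "1 \<le> n"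
  shows "\<bar>N / real n - M / real n\<bar> \<le> 2 * K * real n powr (- 1 / 2)"
proof -
  define r where "r = sqrt (real n)"
  have r: "0 < r" "real n = r\<^sup>2" using assms(5) by (simp_all add: r_def)
  have powr: "real n powr (- 1 / 2) = 1 / r"
    using powr_minus_divide[of "real n" "1 / 2"] by (simp add: r_def powr_half_sqrt)
  have "e \<le> 2 * r"
    using assms(2) r by (intro power2_le_imp_le[of e "2 * r"]) (auto simp: power_mult_distrib)
  then have "K * e \<le> K * (2 * r)"
    using assms(4) by (rule mult_left_mono)
  then have "\<bar>N - M\<bar> \<le> K * (2 * r)" using assms(1) by linarith
  then have "\<bar>N - M\<bar> / r\<^sup>2 \<le> K * (2 * r) / r\<^sup>2"
    by (intro divide_right_mono) auto
  also have "\<dots> = 2 * K * (1 / r)" using r(1) by (simp add: power2_eq_square)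
  finally show ?thesis
    unfolding powr unfolding r(2) using r(1) by (simp add: diff_divide_distrib[symmetric] abs_divide)
qed

text \<open>Negative powers become linear in \<open>golden\<close>, so that the final identities
  follow from \<open>golden * golden = golden + 1\<close>.\<close>

lemma golden_inverse_powers:
  "golden powi (- 1) = golden - 1" "golden powi (- 2) = 2 - golden"
  "golden powi (- 3) = 2 * golden - 3" "golden powi (- 5) = 5 * golden - 8"
proof -
  have sq: "golden * golden = golden + 1"
    using golden_sq by (simp add: power2_eq_square)
  have nz: "golden \<noteq> 0" using golden_bounds by simp
  have eqI: "golden powi (- int k) = y" if "y * golden ^ k = 1" for k y
    using that nz by (simp add: power_int_minus field_simps)
  show "golden powi (- 1) = golden - 1"
    using eqI[of "golden - 1" 1] sq by (simp add: algebra_simps)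
  have p2: "golden ^ 2 = golden + 1" by (rule golden_sq)
  have p3: "golden ^ 3 = 2 * golden + 1"
    using sq by (simp add: power3_eq_cube algebra_simps)
  have "golden ^ 5 = golden ^ 2 * golden ^ 3" by (simp add: power_add[symmetric])
  then have p5: "golden ^ 5 = 5 * golden + 3"
    unfolding p2 p3 using sq by (simp add: algebra_simps)
  show "golden powi (- 2) = 2 - golden"
    using eqI[of "2 - golden" 2] sq by (simp add: p2 algebra_simps)
  show "golden powi (- 3) = 2 * golden - 3"
    using eqI[of "2 * golden - 3" 3] sq by (simp add: p3 algebra_simps)
  show "golden powi (- 5) = 5 * golden - 8"
    using eqI[of "5 * golden - 8" 5] sq by (simp add: p5 algebra_simps)
qed

text \<open>Otherwise \<open>5 * n\<close> would be at most \<open>golden ^ 3 < 5\<close>. This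
  makes \<open>p = 2 * j + 3\<close> solvable with \<open>j \<ge> 0\<close> for odd
  \<open>p\<close>, and \<open>p = 2 * j + 2\<close> with \<open>j \<ge> 1\<close> for even
  \<open>p\<close>.\<close>

lemma exponent_ge_3:
  assumes "1 \<le> n" "real n = u / 5 * golden powi p" "0 \<le> u" "u < golden"
  shows "3 \<le> p"
proof (rule ccontr)
  assume "\<not> 3 \<le> p"
  then have "golden powi p \<le> golden powi 2"
    using golden_bounds by (intro power_int_increasing) auto
  then have "u * golden powi p \<le> golden * golden powi 2"
    using assms(3,4) golden_bounds by (intro mult_mono) auto
  also have "\<dots> = 2 * golden + 1"
    using golden_sq by (simp add: power2_eq_square algebra_simps)
  finally show False using assms(1,2) golden_bounds by simp
qed

text \<open>The variable \<open>u\<close> stands for \<open>sqrt 5 * c\<close>. Its range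
  \<open>1 \<le> u < golden\<close> becomes the range of \<open>n\<close> required for the
  count.\<close>

lemma two_good_density_odd:
  assumes "1 \<le> n" "real n = u / 5 * golden powi p" "1 \<le> u" "u < golden" "odd p"
  shows "\<bar>two_good_density n - 1 / (2 * golden ^ 4 * u)\<bar> \<le> 4 * real n powr (- 1 / 2)"
proof -
  have "3 \<le> p" using exponent_ge_3 assms by simp
  moreover obtain i where i: "p = 2 * i + 1" using assms(5) by (elim oddE)
  ultimately have "0 \<le> i - 1" by simp
  then obtain j where j: "i - 1 = int j" using zero_le_imp_eq_int by blast
  define e where "e = golden ^ j"
  have g: "1.6 < golden" "golden < 1.62" by (rule golden_bounds)+
  have e: "1 \<le> e" unfolding e_def by (rule golden_power_ge_1)
  have "p = int (2 * j + 3)" using i j by simp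
  then have "golden powi p = golden ^ (2 * j + 3)" by (simp only: power_int_of_nat)
  also have "\<dots> = golden ^ 3 * e\<^sup>2"
    by (simp add: e_def power_add power_mult power2_eq_square mult_ac power_mult_distrib)
  finally have n: "5 * real n = u * (golden ^ 3 * e\<^sup>2)" using assms(2) by simp
  have pos: "0 < golden ^ 3 * e\<^sup>2" using g e by simp
  have lower: "golden ^ 3 * e\<^sup>2 \<le> 5 * real n"
    unfolding n using mult_right_mono[of 1 u "golden ^ 3 * e\<^sup>2"] pos assms(3) by simp
  have upper: "5 * real n < golden ^ 4 * e\<^sup>2"
    unfolding n using mult_strict_right_mono[OF assms(4) pos] by (simp add: eval_nat_numeral)
  have "2 * e\<^sup>2 \<le> golden ^ 3 * e\<^sup>2"
    using power_mono[of "1.6" golden 3] g by (intro mult_right_mono) (auto simp: eval_nat_numeral)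
  then have "e\<^sup>2 \<le> 4 * real n" using lower by simp
  then have "\<bar>two_good_density n - e\<^sup>2 / (10 * golden) / real n\<bar> \<le> 2 * 2 * real n powr (- 1 / 2)"
    unfolding two_good_density_def
    using card_two_good_odd[of j n] lower upper assms(1) e
    by (intro divide_error_le[where e = e]) (auto simp: e_def)
  moreover have "e\<^sup>2 / (10 * golden) / real n = 1 / (2 * golden ^ 4 * u)"
  proof -
    have "real n = u * (golden ^ 3 * e\<^sup>2) / 5" using n by simp
    then show ?thesis
      using g e assms(3) by (simp add: field_simps eval_nat_numeral)
  qed
  ultimately show ?thesis by simp
qed

text \<open>Both even cases in one formula: the count is divided by \<open>n = u * E\<close>, and
  the positive part tells whether the line passes the corner of the cut triangle.\<close>

lemma two_good_density_even:
  assumes "1 \<le> n" "real n = u / 5 * golden powi p" "1 \<le> u" "u < golden" "even p"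
  shows "\<bar>two_good_density n - (u / 2 - 1 + (1 + golden powi (- 5)) / (2 * u)
      - (max 0 (u - 2 / golden))\<^sup>2 * golden / (2 * u))\<bar> \<le> 34 * real n powr (- 1 / 2)"
proof -
  have "3 \<le> p" using exponent_ge_3 assms by simp
  moreover obtain i where i: "p = 2 * i" using assms(5) by (elim evenE)
  ultimately have "0 \<le> i - 1" "1 < i" by simp_all
  then obtain j where j: "i - 1 = int j" using zero_le_imp_eq_int by blast
  have "1 \<le> j" using \<open>1 < i\<close> j by simp
  define e where "e = golden ^ j"
  define E where "E = golden\<^sup>2 * e\<^sup>2 / 5"
  have g: "1.6 < golden" "golden < 1.62" by (rule golden_bounds)+
  have e: "1 \<le> e" unfolding e_def by (rule golden_power_ge_1)
  have "p = int (2 * j + 2)" using i j by simp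
  then have "golden powi p = golden ^ (2 * j + 2)" by (simp only: power_int_of_nat)
  also have "\<dots> = golden\<^sup>2 * e\<^sup>2"
    by (simp add: e_def power_add power_mult power2_eq_square mult_ac power_mult_distrib)
  finally have n: "real n = u * E" using assms(2) by (simp add: E_def)
  have E: "0 < E" using g e by (simp add: E_def)
  have lower: "golden\<^sup>2 * e\<^sup>2 \<le> 5 * real n"
    using mult_right_mono[of 1 u E] E assms(3) unfolding n by (simp add: E_def)
  have upper: "5 * real n < golden ^ 3 * e\<^sup>2"
    using mult_strict_right_mono[OF assms(4) E] unfolding n by (simp add: E_def eval_nat_numeral)
  have "2 * e\<^sup>2 \<le> golden\<^sup>2 * e\<^sup>2"
    using power_mono[of "1.6" golden 2] g by (intro mult_right_mono) (auto simp: eval_nat_numeral)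
  then have sq: "e\<^sup>2 \<le> 4 * real n" using lower by simp
  define M where "M = E / (2 * golden ^ 5) + (real n - E)\<^sup>2 / E / 2
        - (max 0 (real n - 2 * (E / golden)))\<^sup>2 / (E / golden) / 2"
  have "\<bar>two_good_density n - M / real n\<bar> \<le> 2 * 17 * real n powr (- 1 / 2)"
    unfolding two_good_density_def
    using card_two_good_even[OF \<open>1 \<le> j\<close>, of n] lower upper assms(1) e sq
    by (intro divide_error_le[where e = e]) (auto simp: e_def M_def E_def)
  moreover have "M / real n = u / 2 - 1 + (1 + golden powi (- 5)) / (2 * u)
      - (max 0 (u - 2 / golden))\<^sup>2 * golden / (2 * u)"
  proof -
    have "max 0 (real n - 2 * (E / golden)) = E * max 0 (u - 2 / golden)"
      using E g by (auto simp: n max_def field_simps)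
    moreover have "golden powi (- 5) = 1 / golden ^ 5"
      using power_int_minus[of golden 5] by (simp add: divide_inverse)
    moreover have "E / (2 * golden ^ 5) / (u * E) = 1 / golden ^ 5 / (2 * u)"
      using E by simp
    moreover have "(u * E - E)\<^sup>2 / E / 2 / (u * E) = u / 2 - 1 + 1 / (2 * u)"
      using E assms(3) by (simp add: field_simps power2_eq_square)
    moreover have "(E * m)\<^sup>2 / (E / golden) / 2 / (u * E) = m\<^sup>2 * golden / (2 * u)" for m
      using E assms(3) g by (simp add: field_simps power2_eq_square)
    ultimately show ?thesis
      unfolding M_def by (simp add: n add_divide_distrib diff_divide_distrib)
  qed
  ultimately show ?thesis by simp
qed

theorem theorem2:
  shows "\<exists>C::real. \<forall>(n::nat) (c::real) (p::int).
    1 \<le> n \<longrightarrow> real n = 1 / sqrt 5 * c * golden powi p \<longrightarrow>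
    1 / sqrt 5 \<le> c \<longrightarrow> c < 1 / sqrt 5 * golden \<longrightarrow>
      (odd p \<longrightarrow>
        \<bar>two_good_density n - 1 / (2 * sqrt 5 * golden ^ 4 * c)\<bar>
          \<le> C * real n powr (- 1 / 2)) \<and>
      (even p \<and> c \<le> (1 + golden powi (- 3)) / sqrt 5 \<longrightarrow>
        \<bar>two_good_density n
            - (sqrt 5 / 2 * c + (1 + golden powi (- 5)) / (2 * sqrt 5 * c) - 1)\<bar>
          \<le> C * real n powr (- 1 / 2)) \<and>
      (even p \<and> (1 + golden powi (- 3)) / sqrt 5 \<le> c \<longrightarrow>
        \<bar>two_good_density n
            - (1 - sqrt 5 / 2 * golden powi (- 1) * c
                 - (1 + golden powi (- 2)) / (2 * sqrt 5 * c))\<bar>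
          \<le> C * real n powr (- 1 / 2))"
proof (rule exI[of _ 34], intro allI impI)
  \<comment> \<open>The constant 34 is twice the 17 of the even count; the odd case gives 4.\<close>
  fix n :: nat and c :: real and p :: int
  assume n: "1 \<le> n" "real n = 1 / sqrt 5 * c * golden powi p"
    and c: "1 / sqrt 5 \<le> c" "c < 1 / sqrt 5 * golden"
  define u where "u = sqrt 5 * c"
  have s: "0 < sqrt 5" "sqrt 5 * sqrt 5 = 5" by simp_all
  have c_eq: "c = u / sqrt 5" by (simp add: u_def)
  have u: "1 \<le> u" "u < golden"
    using c by (simp_all add: u_def field_simps)
  have n': "real n = u / 5 * golden powi p"
    using n(2) s by (simp add: c_eq field_simps)
  have g: "1.6 < golden" "golden < 1.62" by (rule golden_bounds)+
  have gg: "golden * golden = golden + 1" using golden_sq by (simp add: power2_eq_square)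
  have inv: "1 / golden = golden - 1"
    using gg g by (simp add: field_simps)
  have nonneg: "0 \<le> real n powr (- 1 / 2)" by simp
  have "\<bar>two_good_density n - 1 / (2 * sqrt 5 * golden ^ 4 * c)\<bar>
          \<le> 34 * real n powr (- 1 / 2)" if "odd p"
  proof -
    have eq: "2 * sqrt 5 * golden ^ 4 * c = 2 * golden ^ 4 * u"
      unfolding u_def by (simp only: mult_ac)
    show ?thesis
      unfolding eq using two_good_density_odd[OF n(1) n' u that] nonneg by linarith
  qed
  moreover have "\<bar>two_good_density n
      - (sqrt 5 / 2 * c + (1 + golden powi (- 5)) / (2 * sqrt 5 * c) - 1)\<bar>
          \<le> 34 * real n powr (- 1 / 2)" if "even p" "c \<le> (1 + golden powi (- 3)) / sqrt 5"
  proof -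
    \<comment> \<open>The threshold agrees with the corner because
      \<open>1 + golden powi (- 3) = 2 * golden - 2 = 2 / golden\<close>.\<close>
    have "u \<le> 2 * (1 / golden)"
      using that(2) unfolding inv golden_inverse_powers by (simp add: u_def field_simps)
    then have "max 0 (u - 2 / golden) = 0" by simp
    then show ?thesis
      using two_good_density_even[OF n(1) n' u that(1)] by (simp add: u_def algebra_simps)
  qed
  moreover have "\<bar>two_good_density n
      - (1 - sqrt 5 / 2 * golden powi (- 1) * c - (1 + golden powi (- 2)) / (2 * sqrt 5 * c))\<bar>
          \<le> 34 * real n powr (- 1 / 2)" if "even p" "(1 + golden powi (- 3)) / sqrt 5 \<le> c"
  proof -
    have "2 * (1 / golden) \<le> u"
      using that(2) unfolding inv golden_inverse_powers by (simp add: u_def field_simps)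
    then have max: "max 0 (u - 2 / golden) = u - 2 * (golden - 1)"
      unfolding inv[symmetric] by simp
    \<comment> \<open>Grouped so that the brackets reduce to 1 and to
      \<open>golden - 1\<close>.\<close>
    have "(u - 2 * (golden - 1))\<^sup>2 * golden =
        u * u * golden - 4 * u * (golden * golden - golden)
        + 4 * (golden * golden * golden - 2 * golden * golden + golden)"
      by (simp add: power2_eq_square algebra_simps)
    also have "\<dots> = u * u * golden - 4 * u + 4 * (golden - 1)"
      using gg by (simp add: algebra_simps)
    finally have square: "(u - 2 * (golden - 1))\<^sup>2 * golden = u * u * golden - 4 * u + 4 * (golden - 1)" .
    have eq: "u / 2 - 1 + (1 + (5 * golden - 8)) / (2 * u)
        - (u - 2 * (golden - 1))\<^sup>2 * golden / (2 * u) =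
      1 - u / 2 * (golden - 1) - (1 + (2 - golden)) / (2 * u)"
      unfolding square using u by (simp add: field_simps)
    have u_eq: "sqrt 5 / 2 * (golden - 1) * c = u / 2 * (golden - 1)" "2 * sqrt 5 * c = 2 * u"
      by (simp_all add: u_def)
    show ?thesis
      using two_good_density_even[OF n(1) n' u that(1)]
      unfolding max golden_inverse_powers eq u_eq .
  qed
  ultimately show "(odd p \<longrightarrow>
        \<bar>two_good_density n - 1 / (2 * sqrt 5 * golden ^ 4 * c)\<bar>
          \<le> 34 * real n powr (- 1 / 2)) \<and>
      (even p \<and> c \<le> (1 + golden powi (- 3)) / sqrt 5 \<longrightarrow>
        \<bar>two_good_density n
            - (sqrt 5 / 2 * c + (1 + golden powi (- 5)) / (2 * sqrt 5 * c) - 1)\<bar>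
          \<le> 34 * real n powr (- 1 / 2)) \<and>
      (even p \<and> (1 + golden powi (- 3)) / sqrt 5 \<le> c \<longrightarrow>
        \<bar>two_good_density n
            - (1 - sqrt 5 / 2 * golden powi (- 1) * c
                 - (1 + golden powi (- 2)) / (2 * sqrt 5 * c))\<bar>
          \<le> 34 * real n powr (- 1 / 2))"
    by blast
qed

end
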